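(* Let $m,n\in\frac1T\mathbb N$. Then $*^T_{m,m,m}$ induces a well-defined product on $A^T_m(V)$ making it an associative $\mathbb C$-algebra with identity the class of $\mathbf 1$, and $A^T_{n,m}(V)$ is an $A^T_n(V)$-$A^T_m(V)$-bimodule, where the left action of $A^T_n(V)$ is induced by $*^T_{n,n,m}$ and the right action of $A^T_m(V)$ is induced by $*^T_{n,m,m}$.
   Context: Throughout, $T$ is a positive integer and $V$ is a vertex algebra (vertex operator $Y(a,x)=\sum_{i\in\mathbb Z}a_ix^{-i-1}$, vacuum $\mathbf 1$) with a grading $V=\bigoplus_{i\ge\Delta}V_i$, $\Delta\in\mathbb Z_{\le0}$, such that $\mathbf 1\in V_0$ and $a_iV_j\subset V_{\mathrm{wt}a-1-i+j}$ for homogeneous $a$ ($\mathrm{wt}\,a=k$ for $a\in V_k$; $V_k=0$ for $k<\Delta$). $\mathbb N=\{0,1,2,\dots\}$. For rationals $i,j$, $\delta(i\le j)$ is $1$ if $i\le j$ and $0$ otherwise. For $i,j\in\frac1T\mathbb Z$, $\langle i-j\rangle$ is the unique integer $r$ with $0\le r\le T-1$ and $i-j-r/T\in\mathbb Z$. $\mathrm{Res}_x$ is the coefficient of $x^{-1}$; $(1+x)^c$ ($c\in\mathbb Q$) is $\sum_{k\ge0}\binom ckx^k$. For $f(z)=\sum_j\lambda_jz^j\in\mathbb C[z,z^{-1}]$ and $a,b\in V$, $f(z)|_{z^j=a_jb}=\sum_j\lambda_ja_jb$. Polynomial subspaces: for $N,q\in\mathbb Z$, $Q\in\mathbb Q$,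 $O(N,Q,q;z)\subset\mathbb C[z,z^{-1}]$ is spanned by $z^i$ ($i\ge N+1$) and $\sum_{i=0}^{N-q-j}\binom Qiz^{i+q+j}$ ($j=0,-1,-2,\dots$). For $m=l_1+i_1/T$, $n=l_3+i_3/T\in\frac1T\mathbb N$ ($l_1,l_3\in\mathbb N$, $0\le i_1,i_3\le T-1$), $\alpha,\beta\in\mathbb Z$, $s\in\{0,\dots,T-1\}$: $\mathcal O^{T,s}_{n,m}(\alpha,\beta;z)=O(\alpha+\beta-1-\Delta,\ \alpha-1+l_1+\delta(s\le i_1)+s/T,\ -l_1-l_3-\delta(s\le i_1)-\delta(T\le s+i_3)-1;z)$, and $\mathcal O^T_{n,m}(\alpha,\beta;z)=\bigcap_s\mathcal O^{T,s}_{n,m}(\alpha,\beta;z)$. Idempotent polynomials: put $N=\alpha+\beta-1-\Delta$ and $D=N+l_1+l_3+3$. For $r\in\{0,\dots,T-1\}$ and $i\in\mathbb Z$, $e^{T,r}_{n,m}(\alpha,\beta,i;z)=0$ if $i\ge N+1$ or $D\le0$; otherwise it is the unique Laurent polynomial in $\mathrm{span}\{z^k:N+1-TD\le k\le N\}$ with $e^{T,r}_{n,m}(\alpha,\beta,i;z)\equiv\delta_{r,s}z^i$ modulo $O(N,\alpha-1+l_1+\delta(s\le i_1)+s/T,-l_1-l_3-3;z)$ for every $s\in\{0,\dots,T-1\}$. Product: for $p=l_2+i_2/T\in\frac1T\mathbb N$ ($l_2\in\mathbb N$, $0\le i_2\le T-1$), let $r=\langle p-n\rangle$, $\mu=l_2-l_1-l_3-\delta(r\le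 i_1)-\delta(T\le r+i_3)$, and $P^T_{n,p,m}(\alpha,\beta;z)=\sum_{i=0}^{l_2}\binom{\mu}{i}\mathrm{Res}_x\Big((1+x)^{\alpha-1+l_1+\delta(r\le i_1)+r/T}x^{\mu-i}\sum_{j\in\mathbb Z}e^{T,r}_{n,m}(\alpha,\beta,j;z)x^{-j-1}\Big)$. For homogeneous $a,b\in V$, $a*^T_{n,p,m}b=P^T_{n,p,m}(\mathrm{wt}\,a,\mathrm{wt}\,b;z)|_{z^j=a_jb}$, extended bilinearly. Subspaces of $V$: $O^T_{0,n,m}(V)$ is spanned by $a_{-2}\mathbf 1+(\mathrm{wt}\,a+m-n)a$ ($a$ homogeneous); $O^T_{1,n,m}(V)$ is spanned by $f(z)|_{z^j=a_jb}$ for homogeneous $a,b$ and $f\in\mathcal O^T_{n,m}(\mathrm{wt}\,a,\mathrm{wt}\,b;z)$; $O^T_{2,n,m}(V)$ is spanned by $u*^T_{n,p_3,m}\big((a*^T_{p_3,p_2,p_1}b)*^T_{p_3,p_1,m}c-a*^T_{p_3,p_2,m}(b*^T_{p_2,p_1,m}c)\big)$ for $a,b,c,u\in V$, $p_1,p_2,p_3\in\frac1T\mathbb N$; $O^T_{3,n,m}(V)$ is spanned by $(u*^T_{n,p_2,p_1}y)*^T_{n,p_1,m}c$ for $u,c\in V$, $p_1,p_2\in\frac1T\mathbb N$, $y\in O^T_{0,p_2,p_1}(V)+O^T_{1,p_2,p_1}(V)$. $O^T_{n,m}(V)=\sum_{k=0}^3O^T_{k,n,m}(V)$, $A^T_{n,m}(V)=V/O^T_{n,m}(V)$,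 and $A^T_m(V)=A^T_{m,m}(V)$. *)

theory Defs
  imports Complex_Main
begin

text \<open>A vertex algebra with grading is bundled in a record: the complex scalar
multiplication, the modes Y a i b = a_i b, the vacuum, the graded pieces V_k and
the lower bound Delta of the grading.\<close>

record 'v gVA =
  scl  :: "complex \<Rightarrow> 'v \<Rightarrow> 'v"
  md   :: "'v \<Rightarrow> int \<Rightarrow> 'v \<Rightarrow> 'v"
  vac  :: "'v"
  grd  :: "int \<Rightarrow> 'v set"
  Dlt  :: int

definition graded_VA :: "('v::ab_group_add) gVA \<Rightarrow> bool" where
  "graded_VA V \<longleftrightarrow>
     vector_space (scl V)
   \<and> (\<forall>k. module.subspace (scl V) (grd V k))
   \<comment> \<open>V is the direct sum of the V_k\<close>
   \<and> (\<forall>v. \<exists>!f. finite {k. f k \<noteq> 0} \<and> (\<forall>k. f k \<in> grd V k)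
                \<and> v = (\<Sum>k\<in>{k. f k \<noteq> 0}. f k))
   \<and> Dlt V \<le> 0
   \<and> (\<forall>k. k < Dlt V \<longrightarrow> grd V k = {0})
   \<and> vac V \<in> grd V 0
   \<comment> \<open>bilinearity of the modes\<close>
   \<and> (\<forall>a i. Vector_Spaces.linear (scl V) (scl V) (md V a i))
   \<and> (\<forall>i b. Vector_Spaces.linear (scl V) (scl V) (\<lambda>a. md V a i b))
   \<comment> \<open>compatibility with the grading\<close>
   \<and> (\<forall>a b k j i. a \<in> grd V k \<longrightarrow> b \<in> grd V j \<longrightarrow> md V a i b \<in> grd V (k - 1 - i + j))
   \<comment> \<open>vacuum axiom and creation property\<close>
   \<and> (\<forall>i b. md V (vac V) i b = (if i = -1 then b else 0))
   \<and> (\<forall>a i. i \<ge> 0 \<longrightarrow> md V a i (vac V) = 0)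
   \<and> (\<forall>a. md V a (-1) (vac V) = a)
   \<comment> \<open>Borcherds (Jacobi) identity in modes; the sums are finite and M bounds them\<close>
   \<and> (\<forall>a b c p q r M. (\<forall>i\<ge>M. md V a (r + int i) b = 0 \<and> md V b (q + int i) c = 0
                                   \<and> md V a (p + int i) c = 0) \<longrightarrow>
        (\<Sum>i<M. scl V (of_int p gchoose i) (md V (md V a (r + int i) b) (p + q - int i) c))
      = (\<Sum>i<M. scl V ((-1) ^ i * (of_int r gchoose i))
              (md V a (p + r - int i) (md V b (q + int i) c)
               - scl V ((-1) powi r) (md V b (q + r - int i) (md V a (p + int i) c)))))"

definition comp :: "('v::ab_group_add) gVA \<Rightarrow> 'v \<Rightarrow> int \<Rightarrow> 'v" where
  "comp V v = (THE f. finite {k. f k \<noteq> 0}\<and> (\<forall>k. f k \<in> grd V k) \<and> v = (\<Sum>k\<in>{k. f k \<noteq> 0}. f k))"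

definition bilin :: "(complex \<Rightarrow> 'v::ab_group_add \<Rightarrow> 'v) \<Rightarrow> ('v \<Rightarrow> 'v \<Rightarrow> 'v) \<Rightarrow> bool" where
  "bilin sc f \<longleftrightarrow> (\<forall>x. Vector_Spaces.linear sc sc (f x)) \<and> (\<forall>y. Vector_Spaces.linear sc sc (\<lambda>x. f x y))"

section \<open>Laurent polynomials in z, as finitely supported coefficient functions\<close>

definition mono :: "int \<Rightarrow> int \<Rightarrow> complex" where
  "mono i = (\<lambda>k. if k = i then 1 else 0)"

definition fspan :: "(int \<Rightarrow> complex) set \<Rightarrow> (int \<Rightarrow> complex) set" where
  "fspan G = {(\<lambda>k. \<Sum>g\<in>S. c g * g k) | S c. finite S \<and> S \<subseteq> G}"

definition Opoly :: "int \<Rightarrow> complex \<Rightarrow> int \<Rightarrow> (int \<Rightarrow> complex) set" where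
  "Opoly N Q q = fspan ({mono i | i. i \<ge> N + 1}
      \<union> {(\<lambda>k. \<Sum>i\<in>{0..N - q - j}. (Q gchoose nat i) * mono (i + q + j) k) | j. j \<le> 0})"

text \<open>Elements of (1/T)N are encoded by naturals: mm encodes m = mm/T,
  with l = mm div T and i = mm mod T.\<close>
definition dl :: "bool \<Rightarrow> int" where "dl b = (if b then 1 else 0)"

definition Qs :: "nat \<Rightarrow> nat \<Rightarrow> int \<Rightarrow> nat \<Rightarrow> complex" where
  "Qs T mm \<alpha> s = of_int (\<alpha> - 1 + int (mm div T) + dl (s \<le> mm mod T)) + of_nat s / of_nat T"

definition OTs :: "int \<Rightarrow> nat \<Rightarrow> nat \<Rightarrow> nat \<Rightarrow> int \<Rightarrow> int \<Rightarrow> nat \<Rightarrow> (int \<Rightarrow> complex) set" where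
  "OTs \<Delta> T nn mm \<alpha> \<beta> s = Opoly (\<alpha> + \<beta> - 1 - \<Delta>) (Qs T mm \<alpha> s)
      (- int (mm div T) - int (nn div T) - dl (s \<le> mm mod T) - dl (T \<le> s + nn mod T) - 1)"

definition OT :: "int \<Rightarrow> nat \<Rightarrow> nat \<Rightarrow> nat \<Rightarrow> int \<Rightarrow> int \<Rightarrow> (int \<Rightarrow> complex) set" where
  "OT \<Delta> T nn mm \<alpha> \<beta> = (\<Inter>s\<in>{0..<T}. OTs \<Delta> T nn mm \<alpha> \<beta> s)"

definition idem :: "int \<Rightarrow> nat \<Rightarrow> nat \<Rightarrow> nat \<Rightarrow> int \<Rightarrow> int \<Rightarrow> nat \<Rightarrow> int \<Rightarrow> (int \<Rightarrow> complex)" where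
  "idem \<Delta> T nn mm \<alpha> \<beta> r i =
    (let N = \<alpha> + \<beta> - 1 - \<Delta>; D = N + int (mm div T) + int (nn div T) + 3 in
     if i \<ge> N + 1 \<or> D \<le> 0 then (\<lambda>_. 0)
     else (THE e. (\<forall>k. e k \<noteq> 0 \<longrightarrow> N + 1 - int T * D \<le> k \<and> k \<le> N)
             \<and> (\<forall>s<T. (\<lambda>k. e k - (if r = s then mono i k else 0))
                      \<in> Opoly N (Qs T mm \<alpha> s) (- int (mm div T) - int (nn div T) - 3))))"

text \<open>The product polynomial P^T_{n,p,m}(alpha,beta;z); the residue
  Res_x((1+x)^c x^(mu-i) sum_j e_j(z) x^(-j-1)) is written out as
  sum_{j >= mu-i} binom(c, j-mu+i) e_j(z) (e_j = 0 for j > N).\<close>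
definition Ppoly :: "int \<Rightarrow> nat \<Rightarrow> nat \<Rightarrow> nat \<Rightarrow> nat \<Rightarrow> int \<Rightarrow> int \<Rightarrow> (int \<Rightarrow> complex)" where
  "Ppoly \<Delta> T nn pp mm \<alpha> \<beta> =
    (let N = \<alpha> + \<beta> - 1 - \<Delta>;
         r = nat ((int pp - int nn) mod int T);
         \<mu> = int (pp div T) - int (mm div T) - int (nn div T) - dl (r \<le> mm mod T) - dl (T \<le> r + nn mod T);
         c = Qs T mm \<alpha> r
     in (\<lambda>k. \<Sum>i\<in>{0..pp div T}. (of_int \<mu> gchoose i) *
            (\<Sum>j\<in>{\<mu> - int i..N}. (c gchoose nat (j - \<mu> + int i)) * idem \<Delta> T nn mm \<alpha> \<beta> r j k)))"

definition apl :: "('v::ab_group_add) gVA \<Rightarrow> (int \<Rightarrow> complex) \<Rightarrow> 'v \<Rightarrow> 'v \<Rightarrow> 'v" where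
  "apl V f a b = (\<Sum>k\<in>{k. f k \<noteq> 0}. scl V (f k) (md V a k b))"

definition star :: "('v::ab_group_add) gVA \<Rightarrow> nat \<Rightarrow> nat \<Rightarrow> nat \<Rightarrow> nat \<Rightarrow> 'v \<Rightarrow> 'v \<Rightarrow> 'v" where
  "star V T nn pp mm a b =
     (\<Sum>\<alpha>\<in>{k. comp V a k \<noteq> 0}. \<Sum>\<beta>\<in>{k. comp V b k \<noteq> 0}.
        apl V (Ppoly (Dlt V) T nn pp mm \<alpha> \<beta>) (comp V a \<alpha>) (comp V b \<beta>))"

definition O0 :: "('v::ab_group_add) gVA \<Rightarrow> nat \<Rightarrow> nat \<Rightarrow> nat \<Rightarrow> 'v set" where
  "O0 V T nn mm = module.span (scl V)
     {md V a (-2) (vac V) + scl V (of_int k + (of_nat mm - of_nat nn) / of_nat T) a | a k. a \<in> grd V k}"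

definition O1 :: "('v::ab_group_add) gVA \<Rightarrow> nat \<Rightarrow> nat \<Rightarrow> nat \<Rightarrow> 'v set" where
  "O1 V T nn mm = module.span (scl V)
     {apl V f a b | a b \<alpha> \<beta> f. a \<in> grd V \<alpha> \<and> b \<in> grd V \<beta> \<and> f \<in> OT (Dlt V) T nn mm \<alpha> \<beta>}"

definition O2 :: "('v::ab_group_add) gVA \<Rightarrow> nat \<Rightarrow> nat \<Rightarrow> nat \<Rightarrow> 'v set" where
  "O2 V T nn mm = module.span (scl V)
     {star V T nn p3 mm u (star V T p3 p1 mm (star V T p3 p2 p1 a b) c
                            - star V T p3 p2 mm a (star V T p2 p1 mm b c)) | u a b c p1 p2 p3. True}"

definition O3 :: "('v::ab_group_add) gVA \<Rightarrow> nat \<Rightarrow> nat \<Rightarrow> nat \<Rightarrow> 'v set" where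
  "O3 V T nn mm = module.span (scl V)
     {star V T nn p1 mm (star V T nn p2 p1 u y) c | u c p1 p2 y.
        y \<in> {x + w | x w. x \<in> O0 V T p2 p1 \<and> w \<in> O1 V T p2 p1}}"

definition Otot :: "('v::ab_group_add) gVA \<Rightarrow> nat \<Rightarrow> nat \<Rightarrow> nat \<Rightarrow> 'v set" where
  "Otot V T nn mm = module.span (scl V) (O0 V T nn mm \<union> O1 V T nn mm \<union> O2 V T nn mm \<union> O3 V T nn mm)"

end

theory Submission
  imports
    Defs
    "HOL-Library.Function_Algebras"
    "HOL-Computational_Algebra.Formal_Power_Series"
    "HOL-Computational_Algebra.Polynomial"
begin

text \<open>Sending \<open>z^k\<close> to the polynomial \<open>binom(X, N - k)\<close> identifies the span of the \<open>z^k\<close> with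
  \<open>k \<le> N\<close> with the polynomial ring, and \<open>O(N, Q, q; z)\<close> becomes the ideal of the polynomials that
  vanish at \<open>d - Q\<close> for \<open>0 \<le> d < N - q\<close>. For different residues \<open>s\<close> these node sets are
  disjoint, so the idempotent polynomials exist and are unique by Lagrange interpolation.

  The vacuum is a unit because \<open>1_j b\<close> and, modulo \<open>O_0\<close>, \<open>a_j 1\<close> are multiples of \<open>b\<close> and \<open>a\<close>
  whose coefficients are binomial coefficients; the resulting functionals vanish on the relevant
  \<open>O(N, Q, q; z)\<close>, and the Vandermonde convolution gives them the value 1 on the product polynomial.
  Hence \<open>1 * b = b\<close> exactly and \<open>a * 1\<close> is congruent to \<open>a\<close> modulo \<open>O_0\<close>.

  Then all associators lie in \<open>O_2\<close> (take \<open>u = 1\<close>), \<open>(O_0 + O_1) * V\<close> lies in \<open>O_3\<close> (take \<open>u = 1\<close>),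
  \<open>V * (O_0 + O_1)\<close> lies in \<open>O_0 + O_3\<close> (take \<open>c = 1\<close>), and the products of \<open>O_2\<close> and \<open>O_3\<close> with
  arbitrary elements are handled by reassociating, the main case being the pentagon identity.\<close>

section \<open>Interpolation by binomial coefficients\<close>

lemma newton_combination_poly:
  "\<exists>p. (p = 0 \<or> degree p < M) \<and> (\<forall>x::complex. poly p x = (\<Sum>j<M. c j * (x gchoose j)))"
proof (induction M)
  case 0
  show ?case by (rule exI[of _ 0]) simp
next
  case (Suc M)
  then obtain p where p: "p = 0 \<or> degree p < M" "\<forall>x::complex. poly p x = (\<Sum>j<M. c j * (x gchoose j))"
    by blast
  define q where "q = smult (c M / fact M) (\<Prod>i = 0..<M. [:- of_nat i, 1:] :: complex poly)"
  have "degree (\<Prod>i = 0..<M. [:- of_nat i, 1:] :: complex poly) \<le> M"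
    by (rule order_trans[OF degree_prod_sum_le]) simp_all
  then have "degree q \<le> M"
    unfolding q_def by (rule order_trans[OF degree_smult_le])
  then have "degree (p + q) < Suc M"
    using p(1) by (intro le_imp_less_Suc degree_add_le) auto
  moreover have "poly q x = c M * (x gchoose M)" for x
    by (simp add: q_def poly_prod gbinomial_prod_rev)
  ultimately show ?case using p(2) by (intro exI[of _ "p + q"]) auto
qed

text \<open>A polynomial of degree below M with M roots is zero. The binomial basis is triangular at
  0, 1, 2, ..., so its coefficients then vanish one after another.\<close>

lemma newton_combination_unique:
  fixes S :: "complex set"
  assumes S: "finite S" "card S = M" and van: "\<And>x. x \<in> S \<Longrightarrow> (\<Sum>j<M. c j * (x gchoose j)) = 0"
    and "j < M"
  shows "c j = 0"
proof -
  obtain p where p: "p = 0 \<or> degree p < M" "\<And>x. poly p x = (\<Sum>j<M. c j * (x gchoose j))"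
    using newton_combination_poly by blast
  have "p = 0"
    using p(1) S \<open>j < M\<close> van by (intro poly_eqI_degree[of S]) (auto simp: p(2))
  then have *: "(\<Sum>j<M. c j * (x gchoose j)) = 0" for x
    by (simp flip: p(2))
  show ?thesis using \<open>j < M\<close>
  proof (induction j rule: less_induct)
    case (less n)
    \<comment> \<open>Evaluating at n isolates c n: smaller indices vanish by induction, and
      binom(n, i) = 0 for i > n.\<close>
    have "0 = (\<Sum>j<M. c j * (of_nat n gchoose j))" using * by simp
    also have "\<dots> = (\<Sum>j\<in>{n}. c j * (of_nat n gchoose j))"
    proof (rule sum.mono_neutral_right)
      show "\<forall>i\<in>{..<M} - {n}. c i * (of_nat n gchoose i) = 0"
      proof
        fix i assume i: "i \<in> {..<M} - {n}"
        show "c i * (of_nat n gchoose i) = 0"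
          using i less.IH[of i] by (cases "i < n") (auto simp flip: binomial_gbinomial)
      qed
    qed (use less.prems in auto)
    finally show ?case by (simp flip: binomial_gbinomial)
  qed
qed

lemma newton_expansion:
  fixes p :: "complex poly"
  assumes "p = 0 \<or> degree p < M"
  shows "\<exists>c. \<forall>x. poly p x = (\<Sum>j<M. c j * (x gchoose j))"
  using assms
proof (induction p arbitrary: M)
  case 0
  show ?case by (rule exI[of _ "\<lambda>_. 0"]) simp
next
  case (pCons a p)
  have "0 < M" using pCons.prems pCons.hyps by auto
  then obtain L where L: "M = Suc L" by (cases M) auto
  have "p = 0 \<or> degree p < L" using pCons.prems L by (auto split: if_splits)
  then obtain c where c: "\<And>x. poly p x = (\<Sum>j<L. c j * (x gchoose j))"
    using pCons.IH by blast
  \<comment> \<open>Coefficients of a + x p(x), read off from x binom(x, j) = (j+1) binom(x, j+1) +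
    j binom(x, j): a shifted part, with a in the free place 0, and a diagonal part.\<close>
  define d where "d j = (if j = 0 then a else of_nat j * c (j - 1)) + (if j < L then of_nat j * c j else 0)" for j
  have "poly (pCons a p) x = (\<Sum>j<M. d j * (x gchoose j))" for x
  proof -
    have "x * (x gchoose j) = of_nat (Suc j) * (x gchoose Suc j) + of_nat j * (x gchoose j)" for j
      using gbinomial_mult_1[of x j] by (simp add: algebra_simps)
    then have "poly (pCons a p) x
        = a + (\<Sum>j<L. c j * (of_nat (Suc j) * (x gchoose Suc j) + of_nat j * (x gchoose j)))"
      by (simp add: c sum_distrib_left mult.left_commute[of x])
    also have "\<dots> = (a + (\<Sum>j<L. of_nat (Suc j) * c j * (x gchoose Suc j))) + (\<Sum>j<L. of_nat j * c j * (x gchoose j))"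
      by (simp add: algebra_simps sum.distrib)
    also have "a + (\<Sum>j<L. of_nat (Suc j) * c j * (x gchoose Suc j))
        = (\<Sum>j<M. (if j = 0 then a else of_nat j * c (j - 1)) * (x gchoose j))"
      unfolding L by (subst sum.lessThan_Suc_shift) simp
    also have "(\<Sum>j<L. of_nat j * c j * (x gchoose j)) = (\<Sum>j<M. (if j < L then of_nat j * c j else 0) * (x gchoose j))"
      by (simp add: L)
    finally show ?thesis by (simp add: d_def algebra_simps sum.distrib)
  qed
  then show ?case by blast
qed

text \<open>For a new node a, the old interpolant is corrected by a multiple of the product of the X
  - s, which vanishes on S but not at a.\<close>

lemma lagrange_interpolation_exists:
  fixes S :: "complex set"
  assumes "finite S"
  shows "\<exists>p. (p = 0 \<or> degree p < card S) \<and> (\<forall>x\<in>S. poly p x = y x)"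
  using assms
proof induction
  case empty
  show ?case by auto
next
  case (insert a S)
  then obtain p where p: "p = 0 \<or> degree p < card S" "\<forall>x\<in>S. poly p x = y x" by blast
  define w where "w = (\<Prod>s\<in>S. [:- s, 1:])"
  have w0: "poly w a \<noteq> 0" using insert.hyps by (auto simp: w_def poly_prod)
  have wS: "poly w x = 0" if "x \<in> S" for x using insert.hyps that by (auto simp: w_def poly_prod)
  define q where "q = p + smult ((y a - poly p a) / poly w a) w"
  have "degree w \<le> card S"
    unfolding w_def by (rule order_trans[OF degree_prod_sum_le]) (use insert.hyps in simp_all)
  then have "degree q < card (insert a S)"
    unfolding q_def using p(1) insert.hyps
    by (simp, intro le_imp_less_Suc degree_add_le) (auto intro: order_trans[OF degree_smult_le])
  moreover have "\<forall>x\<in>insert a S. poly q x = y x"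
    using p(2) w0 wS by (auto simp: q_def)
  ultimately show ?case by blast
qed

lemma newton_combination_exists:
  fixes S :: "complex set"
  assumes "finite S"
  shows "\<exists>c. \<forall>x\<in>S. (\<Sum>j<card S. c j * (x gchoose j)) = y x"
  using lagrange_interpolation_exists[OF assms, of y] newton_expansion by metis

section \<open>The quotients by \<^const>\<open>Opoly\<close> and the idempotent polynomials\<close>

text \<open>The coefficient of \<open>x^M\<close> in \<open>(1 + x)^\<rho> f(x)\<close>.\<close>
definition respair :: "complex \<Rightarrow> int \<Rightarrow> (int \<Rightarrow> complex) \<Rightarrow> complex" where
  "respair \<rho> M f = (\<Sum>k | f k \<noteq> 0. f k * (if k \<le> M then \<rho> gchoose nat (M - k) else 0))"

lemma respair_superset:
  assumes "finite S" "\<And>k. f k \<noteq> 0 \<Longrightarrow> k \<in> S"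
  shows "respair \<rho> M f = (\<Sum>k\<in>S. f k * (if k \<le> M then \<rho> gchoose nat (M - k) else 0))"
  unfolding respair_def by (rule sum.mono_neutral_left) (use assms in auto)

definition fscale :: "complex \<Rightarrow> (int \<Rightarrow> complex) \<Rightarrow> int \<Rightarrow> complex" where
  "fscale c f = (\<lambda>k. c * f k)"

interpretation laurent: vector_space fscale
  by standard (auto simp: fscale_def fun_eq_iff algebra_simps)

lemma fscale_apply [simp]: "fscale c f k = c * f k"
  by (simp add: fscale_def)

lemma sum_fun_apply: "(\<Sum>g\<in>S. F g) k = (\<Sum>g\<in>S. F g k)" for F :: "'a \<Rightarrow> 'b \<Rightarrow> 'c::comm_monoid_add"
  by (induction S rule: infinite_finite_induct) auto

lemma fspan_eq_span: "fspan G = laurent.span G"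
  unfolding fspan_def laurent.span_explicit
proof (intro Collect_cong iff_exI arg_cong2[where f = "(\<and>)"] refl)
  fix f S c
  show "(f = (\<lambda>k. \<Sum>g\<in>S. c g * g k)) = (f = (\<Sum>a\<in>S. fscale (c a) a))"
    by (simp add: fun_eq_iff sum_fun_apply)
qed

text \<open>\<open>laurent\<close> is the space of all functions, but a sum over an infinite set
  defaults to 0, so linearity of \<open>respair\<close> is only available for finite
  support.\<close>

definition finsupp :: "(int \<Rightarrow> complex) \<Rightarrow> bool" where
  "finsupp f \<longleftrightarrow> finite {k. f k \<noteq> 0}"

lemma finsupp_subset: "finite S \<Longrightarrow> (\<And>k. f k \<noteq> 0 \<Longrightarrow> k \<in> S) \<Longrightarrow> finsupp f"
  unfolding finsupp_def by (rule finite_subset) auto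

lemma finsupp_zero [simp]: "finsupp 0" by (simp add: finsupp_def)

lemma finsupp_mono [simp]: "finsupp (mono i)"
  by (rule finsupp_subset[of "{i}"]) (auto simp: mono_def split: if_splits)

lemma finsupp_lincomb:
  assumes "finsupp f" "finsupp g" shows "finsupp (fscale c f + g)"
  by (rule finsupp_subset[of "{k. f k \<noteq> 0} \<union> {k. g k \<noteq> 0}"]) (use assms in \<open>auto simp: finsupp_def\<close>)

lemma respair_lincomb:
  assumes "finsupp f" "finsupp g"
  shows "respair \<rho> M (fscale c f + g) = c * respair \<rho> M f + respair \<rho> M g"
proof -
  let ?S = "{k. f k \<noteq> 0} \<union> {k. g k \<noteq> 0}"
  have fin: "finite ?S" using assms by (auto simp: finsupp_def)
  have "respair \<rho> M (fscale c f + g) = (\<Sum>k\<in>?S. (fscale c f + g) k * (if k \<le> M then \<rho> gchoose nat (M - k) else 0))"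
    by (rule respair_superset) (use fin in auto)
  moreover have "respair \<rho> M f = (\<Sum>k\<in>?S. f k * (if k \<le> M then \<rho> gchoose nat (M - k) else 0))"
    by (rule respair_superset) (use fin in auto)
  moreover have "respair \<rho> M g = (\<Sum>k\<in>?S. g k * (if k \<le> M then \<rho> gchoose nat (M - k) else 0))"
    by (rule respair_superset) (use fin in auto)
  ultimately show ?thesis by (simp add: sum_distrib_left sum.distrib algebra_simps)
qed

lemma respair_zero [simp]: "respair \<rho> M 0 = 0" by (simp add: respair_def)

lemma respair_diff:
  assumes "finsupp f" "finsupp g"
  shows "respair \<rho> M (f - g) = respair \<rho> M f - respair \<rho> M g"
proof -
  have "f - g = fscale (-1) g + f" by (simp add: fun_eq_iff)
  then show ?thesis using respair_lincomb[OF assms(2,1), of \<rho> M "-1"] by simp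
qed

lemma respair_mono: "respair \<rho> M (mono i) = (if i \<le> M then \<rho> gchoose nat (M - i) else 0)"
  by (subst respair_superset[of "{i}"]) (auto simp: mono_def split: if_splits)

lemma respair_sum:
  assumes "finite A" "\<And>x. x \<in> A \<Longrightarrow> finsupp (F x)"
  shows "finsupp (\<Sum>x\<in>A. fscale (c x) (F x)) \<and>
    respair \<rho> M (\<Sum>x\<in>A. fscale (c x) (F x)) = (\<Sum>x\<in>A. c x * respair \<rho> M (F x))"
  using assms by (induction A) (auto simp: respair_lincomb finsupp_lincomb)

text \<open>Coefficient of x^M in (1+x)^R times x^A (1+x)^Q, the second factor being cut off after
  x^B. As M \<le> B, the cut does not reach that coefficient and Vandermonde applies.\<close>

lemma convolution_int:
  fixes Q R :: complex
  assumes "M \<le> B"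
  shows "(\<Sum>k\<in>{A..B}. (Q gchoose nat (k - A)) * (if k \<le> M then R gchoose nat (M - k) else 0))
    = (if A \<le> M then (Q + R) gchoose nat (M - A) else 0)"
proof (cases "A \<le> M")
  case True
  have "(\<Sum>k\<in>{A..B}. (Q gchoose nat (k - A)) * (if k \<le> M then R gchoose nat (M - k) else 0))
      = (\<Sum>k\<in>{A..M}. (Q gchoose nat (k - A)) * (R gchoose nat (M - k)))"
    by (rule sum.mono_neutral_cong_right) (use assms in auto)
  also have "\<dots> = (\<Sum>i\<in>{0..nat (M - A)}. (Q gchoose i) * (R gchoose (nat (M - A) - i)))"
    by (rule sum.reindex_bij_witness[of _ "\<lambda>i. A + int i" "\<lambda>k. nat (k - A)"])
       (use True in \<open>auto simp: nat_diff_distrib' intro!: arg_cong2[where f = "(gchoose)"]\<close>)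
  also have "\<dots> = (Q + R) gchoose nat (M - A)" by (rule gbinomial_Vandermonde)
  finally show ?thesis using True by simp
next
  case False
  then show ?thesis by (auto intro!: sum.neutral)
qed

lemma Opoly_generators:
  "Opoly N Q q = laurent.span ({mono i | i. i \<ge> N + 1}
      \<union> {(\<Sum>k\<in>{q + j..N}. fscale (Q gchoose nat (k - (q + j))) (mono k)) | j. j \<le> 0})"
proof -
  have "(\<lambda>k. \<Sum>i\<in>{0..N - q - j}. (Q gchoose nat i) * mono (i + q + j) k)
      = (\<Sum>k\<in>{q + j..N}. fscale (Q gchoose nat (k - (q + j))) (mono k))" for j
    unfolding fun_eq_iff sum_fun_apply
    by (intro allI, rule sum.reindex_bij_witness[of _ "\<lambda>k. k - (q + j)" "\<lambda>i. i + q + j"]) auto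
  then show ?thesis by (simp add: Opoly_def fspan_eq_span)
qed

text \<open>A generator is x^(q+j) (1+x)^Q cut off after x^N. Pairing it with (1+x)^(h-Q) leaves a
  coefficient of (1+x)^h beyond its degree. M = N serves the interpolation, M = -1 the
  vacuum.\<close>

lemma Opoly_respair:
  assumes f: "f \<in> Opoly N Q q" and M: "M \<le> N" "int h < M - q"
  shows "finsupp f \<and> respair (of_nat h - Q) M f = 0"
  using f unfolding Opoly_generators
proof (induction rule: laurent.span_induct_alt)
  case base
  show ?case by (simp add: finsupp_def respair_def)
next
  case (step c g f)
  have "finsupp g \<and> respair (of_nat h - Q) M g = 0"
  proof -
    from step(1) consider i where "g = mono i" "i \<ge> N + 1"
      | j where "j \<le> 0" "g = (\<Sum>k\<in>{q + j..N}. fscale (Q gchoose nat (k - (q + j))) (mono k))"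
      by blast
    then show ?thesis
    proof cases
      case 1
      then show ?thesis using M by (simp add: respair_mono)
    next
      case 2
      have "respair (of_nat h - Q) M g = (if q + j \<le> M then of_nat h gchoose nat (M - (q + j)) else 0)"
        unfolding 2 using M(1)
        by (subst respair_sum[THEN conjunct2]) (auto simp: respair_mono convolution_int)
      moreover have "(of_nat h :: complex) gchoose nat (M - (q + j)) = 0"
        using M 2(1) by (simp flip: binomial_gbinomial)
      moreover have "finsupp g" unfolding 2 by (rule respair_sum[THEN conjunct1]) auto
      ultimately show ?thesis by simp
    qed
  qed
  with step(2) show ?case
    using respair_lincomb[of g f "of_nat h - Q" M c] finsupp_lincomb[of g f c]
    by (simp add: plus_fun_def fscale_def)
qed

lemma finsupp_span_mono:
  assumes "finsupp f" shows "f = (\<Sum>k | f k \<noteq> 0. fscale (f k) (mono k))"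
proof
  fix j
  have "(\<Sum>k | f k \<noteq> 0. fscale (f k) (mono k)) j = (\<Sum>k | f k \<noteq> 0. if k = j then f k else 0)"
    unfolding sum_fun_apply by (rule sum.cong) (auto simp: mono_def)
  also have "\<dots> = f j" using assms by (simp add: finsupp_def sum.delta')
  finally show "f j = (\<Sum>k | f k \<noteq> 0. fscale (f k) (mono k)) j" by simp
qed

lemma respair_newton:
  assumes sup: "\<And>k. f k \<noteq> 0 \<Longrightarrow> N - int M < k \<and> k \<le> N"
  shows "respair \<rho> N f = (\<Sum>j<M. f (N - int j) * (\<rho> gchoose j))"
proof -
  have "respair \<rho> N f = (\<Sum>k\<in>{N - int M<..N}. f k * (if k \<le> N then \<rho> gchoose nat (N - k) else 0))"
    by (rule respair_superset) (use sup in auto)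
  also have "\<dots> = (\<Sum>j<M. f (N - int j) * (\<rho> gchoose j))"
    by (rule sum.reindex_bij_witness[of _ "\<lambda>j. N - int j" "\<lambda>k. nat (N - k)"]) auto
  finally show ?thesis .
qed

text \<open>At M = N the pairing evaluates at \<rho> the Newton combination whose coefficients are
  those of f, so uniqueness of interpolation applies.\<close>

lemma eq_zero_if_respair_zero:
  assumes sup: "\<And>k. f k \<noteq> 0 \<Longrightarrow> N - int M < k \<and> k \<le> N"
    and S: "finite S" "card S = M" and van: "\<And>\<rho>. \<rho> \<in> S \<Longrightarrow> respair \<rho> N f = 0"
  shows "f = 0"
proof
  fix k
  have "f (N - int j) = 0" if "j < M" for j
    by (rule newton_combination_unique[OF S _ that, of "\<lambda>j. f (N - int j)"])
       (use van respair_newton[OF sup] in auto)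
  from this[of "nat (N - k)"] sup[of k] show "f k = 0 k" by (cases "f k = 0") (auto simp: nat_less_iff)
qed

text \<open>Converse of \<open>Opoly_respair\<close> at M = N. Modulo \<open>Opoly\<close> every
  Laurent polynomial reduces to exponents in (q, N]; the remainder has as many coefficients as there
  are vanishing conditions.\<close>

lemma Opoly_memI:
  assumes f: "finsupp f" and van: "\<And>d. int d < N - q \<Longrightarrow> respair (of_nat d - Q) N f = 0"
  shows "f \<in> Opoly N Q q"
proof -
  define B where "B = {mono k | k. q < k \<and> k \<le> N}"
  define R where "R = laurent.span (Opoly N Q q \<union> B)"
  have sp: "laurent.span (Opoly N Q q) = Opoly N Q q"
    unfolding Opoly_generators by (rule laurent.span_span)
  have mono_R: "mono k \<in> R" for k
  proof (induction "nat (N + 1 - k)" arbitrary: k rule: less_induct)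
    case less
    consider "k > N" | "q < k" "k \<le> N" | "k \<le> q" "k \<le> N" by linarith
    then show ?case
    proof cases
      case 1
      then have "mono k \<in> Opoly N Q q"
        unfolding Opoly_generators by (intro laurent.span_base) auto
      then show ?thesis unfolding R_def by (intro laurent.span_base) auto
    next
      case 2
      then show ?thesis unfolding R_def B_def by (intro laurent.span_base) auto
    next
      case 3
      \<comment> \<open>The generator with j = k - q has lowest term z^k with coefficient 1, so z^k
        reduces to higher exponents, covered by the induction.\<close>
      define g where "g = (\<Sum>i\<in>{k..N}. fscale (Q gchoose nat (i - k)) (mono i))"
      have "\<exists>j. g = (\<Sum>k\<in>{q + j..N}. fscale (Q gchoose nat (k - (q + j))) (mono k)) \<and> j \<le> 0"
        using 3 by (intro exI[of _ "k - q"]) (simp add: g_def)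
      then have "g \<in> Opoly N Q q"
        unfolding Opoly_generators by (intro laurent.span_base) blast
      then have gR: "g \<in> R" unfolding R_def by (intro laurent.span_base) auto
      have "{k..N} = insert k {k + 1..N}" using 3 by auto
      then have "mono k = g - (\<Sum>i\<in>{k + 1..N}. fscale (Q gchoose nat (i - k)) (mono i))"
        by (simp add: g_def)
      moreover have "(\<Sum>i\<in>{k + 1..N}. fscale (Q gchoose nat (i - k)) (mono i)) \<in> R"
        unfolding R_def
        by (intro laurent.span_sum laurent.span_scale) (use less in \<open>auto simp: R_def\<close>)
      ultimately show ?thesis
        using laurent.span_diff[OF gR[unfolded R_def]] by (simp only: R_def)
    qed
  qed
  have "f \<in> R"
    unfolding R_def
    by (subst finsupp_span_mono[OF f], intro laurent.span_sum laurent.span_scale)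
       (use mono_R in \<open>auto simp: R_def\<close>)
  then obtain g h where gh: "f = g + h" "g \<in> Opoly N Q q" "h \<in> laurent.span B"
    unfolding R_def laurent.span_Un sp by blast
  have hsup: "h k \<noteq> 0 \<longrightarrow> q < k \<and> k \<le> N" for k
    using gh(3)
  proof (induction rule: laurent.span_induct_alt)
    case base
    show ?case by simp
  next
    case (step c x y)
    then show ?case by (auto simp: B_def mono_def split: if_splits)
  qed
  have "h = 0"
  proof (rule eq_zero_if_respair_zero)
    show "N - int (nat (N - q)) < k \<and> k \<le> N" if "h k \<noteq> 0" for k using hsup[of k] that by auto
    let ?S = "(\<lambda>d. of_nat d - Q) ` {d. int d < N - q}"
    have "{d. int d < N - q} = {..<nat (N - q)}" by auto
    then show "finite ?S" "card ?S = nat (N - q)" by (auto simp: card_image inj_on_def)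
    have "finsupp h" by (rule finsupp_subset[of "{q<..N}"]) (use hsup in auto)
    fix \<rho> assume "\<rho> \<in> ?S"
    then obtain d where d: "int d < N - q" "\<rho> = of_nat d - Q" by blast
    have "finsupp g \<and> respair \<rho> N g = 0" using Opoly_respair[OF gh(2) order_refl d(1)] d(2) by simp
    moreover have "h = f - g" using gh(1) by simp
    ultimately show "respair \<rho> N h = 0" using f van[OF d(1)] by (simp add: respair_diff d(2))
  qed
  then show ?thesis using gh by simp
qed

section \<open>Nodes of the different residues and the idempotent polynomials\<close>

text \<open>Apart from s/T all terms of a node are integers, so equal nodes make s - s' a multiple
  of T of absolute value below T.\<close>

lemma Qs_nodes_inj:
  assumes "T > 0"
  shows "inj_on (\<lambda>(s, d). of_nat d - Qs T mm \<alpha> s) ({..<T} \<times> UNIV)"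
proof (rule inj_onI, clarsimp)
  fix s s' d d' :: nat
  assume s: "s < T" "s' < T" and eq: "complex_of_nat d - Qs T mm \<alpha> s = of_nat d' - Qs T mm \<alpha> s'"
  define z where "z = int d - int d' + dl (s' \<le> mm mod T) - dl (s \<le> mm mod T)"
  have "(of_nat s - of_nat s' :: complex) = of_int z * of_nat T"
    using eq assms by (simp add: Qs_def z_def field_simps)
  then have "of_int (int s - int s') = (of_int (z * int T) :: complex)" by simp
  then have st: "int s - int s' = z * int T" unfolding of_int_eq_iff .
  have "\<bar>z * int T\<bar> < int T" using s unfolding st[symmetric] by auto
  then have "z = 0" using assms by (auto simp: abs_mult)
  with st have ss: "s = s'" by simp
  with eq show "s = s' \<and> d = d'" by simp
qed

text \<open>By \<open>Opoly_respair\<close> and \<open>Opoly_memI\<close> the congruences prescribe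
  the pairing at D nodes for each of the T residues: binom(\<rho>, N - i) for residue r, 0 for the
  others. The T D allowed coefficients are thus determined uniquely.\<close>

lemma idem_properties:
  fixes r :: nat
  assumes T: "T > 0" and N: "N = \<alpha> + \<beta> - 1 - \<Delta>"
    and D: "D = N + int (mm div T) + int (nn div T) + 3" "D > 0" and "i \<le> N"
  defines "e \<equiv> idem \<Delta> T nn mm \<alpha> \<beta> r i"
  shows "e k \<noteq> 0 \<longrightarrow> N + 1 - int T * D \<le> k \<and> k \<le> N"
    and "s < T \<Longrightarrow> (\<lambda>k. e k - (if r = s then mono i k else 0))
      \<in> Opoly N (Qs T mm \<alpha> s) (- int (mm div T) - int (nn div T) - 3)"
proof -
  define q where "q = - int (mm div T) - int (nn div T) - 3"
  \<comment> \<open>The predicate under the \<open>THE\<close> in \<open>idem\<close>.\<close>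
  define good where "good e \<longleftrightarrow> (\<forall>k. e k \<noteq> 0 \<longrightarrow> N + 1 - int T * D \<le> k \<and> k \<le> N)
      \<and> (\<forall>s<T. (\<lambda>k. e k - (if r = s then mono i k else 0)) \<in> Opoly N (Qs T mm \<alpha> s) q)" for e
  define M where "M = T * nat D"
  have M: "int M = int T * D" using D(2) by (simp add: M_def)
  have Dq: "D = N - q" by (simp add: D q_def)
  define node where "node = (\<lambda>(s, d). complex_of_nat d - Qs T mm \<alpha> s)"
  define I where "I = {..<T} \<times> {..<nat D}"
  have inj: "inj_on node I" unfolding node_def I_def
    by (rule inj_on_subset[OF Qs_nodes_inj[OF T]]) auto
  have S: "finite (node ` I)" "card (node ` I) = M"
    by (auto simp: I_def M_def card_image inj[unfolded I_def] card_cartesian_product)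
  define F where "F e s = e - (if r = s then mono i else 0)" for e s
  have F_eq: "(\<lambda>k. e k - (if r = s then mono i k else 0)) = F e s" for e s
    by (auto simp: F_def fun_eq_iff)
  have fin: "finsupp e" if "\<forall>k. e k \<noteq> 0 \<longrightarrow> N + 1 - int T * D \<le> k \<and> k \<le> N" for e
    by (rule finsupp_subset[of "{N + 1 - int T * D..N}"]) (use that in auto)
  have resF: "respair \<rho> N (F e s) = respair \<rho> N e - (if r = s then \<rho> gchoose nat (N - i) else 0)"
    if "finsupp e" for \<rho> e s
    using that \<open>i \<le> N\<close> by (auto simp: F_def respair_diff respair_mono)
  have finF: "finsupp (F e s)" if "finsupp e" for e s
    by (rule finsupp_subset[of "insert i {k. e k \<noteq> 0}"])
       (use that in \<open>auto simp: F_def mono_def finsupp_def split: if_splits\<close>)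
  have "\<exists>!e. good e"
  proof (rule ex_ex1I)
    \<comment> \<open>The inverse of \<open>node\<close> recovers the residue to which \<rho>
      belongs.\<close>
    define y where "y \<rho> = (if fst (the_inv_into I node \<rho>) = r then \<rho> gchoose nat (N - i) else 0)" for \<rho>
    obtain c where c: "\<And>\<rho>. \<rho> \<in> node ` I \<Longrightarrow> (\<Sum>j<M. c j * (\<rho> gchoose j)) = y \<rho>"
      using newton_combination_exists[OF S(1), of y] S(2) by auto
    \<comment> \<open>The Newton coefficient c j becomes the coefficient of z^(N-j).\<close>
    define e where "e k = (if N - int M < k \<and> k \<le> N then c (nat (N - k)) else 0)" for k
    have sup: "\<forall>k. e k \<noteq> 0 \<longrightarrow> N + 1 - int T * D \<le> k \<and> k \<le> N" by (auto simp: e_def M)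
    have "respair \<rho> N e = (\<Sum>j<M. e (N - int j) * (\<rho> gchoose j))" for \<rho>
      by (rule respair_newton) (auto simp: e_def split: if_splits)
    then have rese: "respair \<rho> N e = (\<Sum>j<M. c j * (\<rho> gchoose j))" for \<rho>
      by (auto simp: e_def)
    have "F e s \<in> Opoly N (Qs T mm \<alpha> s) q" if s: "s < T" for s
    proof (rule Opoly_memI[OF finF[OF fin[OF sup]]])
      fix d assume "int d < N - q"
      then have sd: "(s, d) \<in> I" using s Dq by (auto simp: I_def)
      then have "the_inv_into I node (node (s, d)) = (s, d)" by (rule the_inv_into_f_f[OF inj])
      then have "respair (node (s, d)) N (F e s) = 0"
        using sd by (simp add: resF fin[OF sup] rese c y_def)
      then show "respair (of_nat d - Qs T mm \<alpha> s) N (F e s) = 0" by (simp add: node_def)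
    qed
    then show "\<exists>e. good e" using sup by (auto simp: good_def F_eq)
  next
    fix e e' assume g: "good e" "good e'"
    have fe: "finsupp e" "finsupp e'" using g fin by (auto simp: good_def)
    have "e - e' = 0"
    proof (rule eq_zero_if_respair_zero[OF _ S])
      fix k assume "(e - e') k \<noteq> 0"
      then have "e k \<noteq> 0 \<or> e' k \<noteq> 0" by auto
      then show "N - int M < k \<and> k \<le> N" using g by (force simp: good_def M)
    next
      fix \<rho> assume "\<rho> \<in> node ` I"
      then obtain s d where sd: "s < T" "int d < N - q" "\<rho> = of_nat d - Qs T mm \<alpha> s"
        by (auto simp: I_def node_def Dq zless_nat_eq_int_zless)
      have "respair \<rho> N (F e s) = 0" "respair \<rho> N (F e' s) = 0"
        using g sd by (auto simp: good_def F_eq dest!: Opoly_respair[OF _ order_refl])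
      then show "respair \<rho> N (e - e') = 0" using fe by (simp add: resF respair_diff)
    qed
    then show "e = e'" by simp
  qed
  from theI'[OF this] have "good e"
    unfolding e_def idem_def Let_def N[symmetric] D(1)[symmetric] q_def[symmetric] good_def[symmetric]
    using \<open>i \<le> N\<close> D(2) by simp
  then show "e k \<noteq> 0 \<longrightarrow> N + 1 - int T * D \<le> k \<and> k \<le> N"
    and "s < T \<Longrightarrow> (\<lambda>k. e k - (if r = s then mono i k else 0))
      \<in> Opoly N (Qs T mm \<alpha> s) (- int (mm div T) - int (nn div T) - 3)"
    by (auto simp: good_def q_def)
qed

text \<open>The congruence modulo \<open>Opoly\<close> is now tested at M = -1, which N \<ge> -1
  permits. The bound on h is h < -1 - q for q = - int (mm div T) - int (nn div T) - 3.\<close>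

lemma respair_idem:
  assumes T: "T > 0" and N: "N = \<alpha> + \<beta> - 1 - \<Delta>" "N \<ge> -1" and i: "i \<le> N" and r: "r < T"
    and h: "int h \<le> int (mm div T) + int (nn div T) + 1"
  shows "finsupp (idem \<Delta> T nn mm \<alpha> \<beta> r i)"
    and "respair (of_nat h - Qs T mm \<alpha> r) (-1) (idem \<Delta> T nn mm \<alpha> \<beta> r i)
      = (if i \<le> -1 then (of_nat h - Qs T mm \<alpha> r) gchoose nat (-1 - i) else 0)"
proof -
  let ?e = "idem \<Delta> T nn mm \<alpha> \<beta> r i"
  have D: "N + int (mm div T) + int (nn div T) + 3 > 0" using N(2) by linarith
  note e = idem_properties[OF T N(1) refl D i]
  show fin: "finsupp ?e"
    by (rule finsupp_subset[of "{N + 1 - int T * (N + int (mm div T) + int (nn div T) + 3)..N}"])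
       (use e(1) in auto)
  have "(\<lambda>k. ?e k - (if r = r then mono i k else 0)) = ?e - mono i" by auto
  with e(2)[OF r, of r] have "?e - mono i \<in> Opoly N (Qs T mm \<alpha> r) (- int (mm div T) - int (nn div T) - 3)"
    by simp
  from Opoly_respair[OF this N(2), of h] h
  have "respair (of_nat h - Qs T mm \<alpha> r) (-1) (?e - mono i) = 0" by simp
  then show "respair (of_nat h - Qs T mm \<alpha> r) (-1) ?e
      = (if i \<le> -1 then (of_nat h - Qs T mm \<alpha> r) gchoose nat (-1 - i) else 0)"
    using fin by (simp add: respair_diff respair_mono)
qed

text \<open>Under the pairing each idempotent polynomial acts as z^j. With \<mu> = -h-1 the
  Vandermonde convolution turns the i-th summand into binom(-h-1, i) binom(h, h+i), and only i = 0
  survives.\<close>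

lemma respair_Ppoly:
  assumes T: "T > 0" and N: "\<alpha> + \<beta> - 1 - \<Delta> \<ge> -1"
    and r: "r = nat ((int pp - int nn) mod int T)"
    and \<mu>: "int (pp div T) - int (mm div T) - int (nn div T) - dl (r \<le> mm mod T) - dl (T \<le> r + nn mod T) = - int h - 1"
  shows "respair (of_nat h - Qs T mm \<alpha> r) (-1) (Ppoly \<Delta> T nn pp mm \<alpha> \<beta>) = 1"
proof -
  define N where "N = \<alpha> + \<beta> - 1 - \<Delta>"
  define c where "c = Qs T mm \<alpha> r"
  define A where "A = Sigma {0..pp div T} (\<lambda>i. {- int h - 1 - int i..N})"
  have rT: "r < T" using T r by (simp add: nat_less_iff)
  \<comment> \<open>Both \<open>dl\<close> terms are at most 1 and pp div T is nonnegative.\<close>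
  have hb: "int h \<le> int (mm div T) + int (nn div T) + 1"
    using \<mu> by (auto simp: dl_def split: if_splits)
  have N1: "N \<ge> -1" using N by (simp add: N_def)
  note e = respair_idem[OF T N_def N1 _ rT hb]
  define w where "w = (\<lambda>(i, j). (of_int (- int h - 1) gchoose i) * (c gchoose nat (j - (- int h - 1 - int i))))"
  have fA: "finite A" by (simp add: A_def)
  have P: "Ppoly \<Delta> T nn pp mm \<alpha> \<beta> = (\<Sum>ij\<in>A. fscale (w ij) (idem \<Delta> T nn mm \<alpha> \<beta> r (snd ij)))"
  proof
    fix k
    show "Ppoly \<Delta> T nn pp mm \<alpha> \<beta> k = (\<Sum>ij\<in>A. fscale (w ij) (idem \<Delta> T nn mm \<alpha> \<beta> r (snd ij))) k"
      unfolding Ppoly_def Let_def r[symmetric] \<mu> N_def[symmetric] c_def[symmetric] sum_fun_apply A_def w_def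
        sum_distrib_left
      by (subst sum.Sigma) (auto intro!: sum.cong simp: algebra_simps)
  qed
  have fin: "finsupp (idem \<Delta> T nn mm \<alpha> \<beta> r (snd ij))" if "ij \<in> A" for ij
    using e(1) that by (auto simp: A_def)
  note rs = respair_sum[OF fA fin, where c = w]
  have "respair (of_nat h - c) (-1) (Ppoly \<Delta> T nn pp mm \<alpha> \<beta>)
      = (\<Sum>ij\<in>A. w ij * (if snd ij \<le> -1 then (of_nat h - c) gchoose nat (-1 - snd ij) else 0))"
    unfolding P by (subst rs[THEN conjunct2]) (use e(2) in \<open>auto simp: A_def c_def intro!: sum.cong\<close>)
  also have "\<dots> = (\<Sum>i\<in>{0..pp div T}. (of_int (- int h - 1) gchoose i) *
      (\<Sum>j\<in>{- int h - 1 - int i..N}. (c gchoose nat (j - (- int h - 1 - int i)))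
         * (if j \<le> -1 then (of_nat h - c) gchoose nat (-1 - j) else 0)))"
    unfolding A_def w_def sum_distrib_left
    by (subst sum.Sigma) (auto intro!: sum.cong simp: algebra_simps)
  also have "\<dots> = (\<Sum>i\<in>{0..pp div T}. (of_int (- int h - 1) gchoose i) * (of_nat h gchoose (h + i)))"
    by (subst convolution_int[OF N1]) (auto simp: nat_add_distrib nat_int_add)
  also have "\<dots> = (\<Sum>i\<in>{0..pp div T}. if i = 0 then 1 else 0)"
    by (rule sum.cong) (auto simp flip: binomial_gbinomial)
  also have "\<dots> = 1" by simp
  finally show "respair (of_nat h - Qs T mm \<alpha> r) (-1) (Ppoly \<Delta> T nn pp mm \<alpha> \<beta>) = 1"
    by (simp add: c_def)
qed

section \<open>The product on a graded vertex algebra and its unit\<close>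

locale graded_vertex_algebra =
  fixes V :: "('v::ab_group_add) gVA" and T :: nat
  assumes VA: "graded_VA V" and T_pos: "T > 0"
begin

sublocale vector_space "scl V"
  by (rule VA[unfolded graded_VA_def, THEN conjunct1])

text \<open>\<open>VA_tail2\<close>, \<open>VA_tail6\<close> and \<open>VA_tail9\<close> drop the
  first 2, 6 and 9 conjuncts of \<open>graded_VA\<close>, to shorten the projections to the later
  axioms.\<close>

lemmas VA_tail2 = VA[unfolded graded_VA_def, THEN conjunct2, THEN conjunct2]
lemmas VA_tail6 = VA_tail2[THEN conjunct2, THEN conjunct2, THEN conjunct2, THEN conjunct2]
lemmas VA_tail9 = VA_tail6[THEN conjunct2, THEN conjunct2, THEN conjunct2]

lemma linear_scl_iff: "Vector_Spaces.linear (scl V) (scl V) f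
    \<longleftrightarrow> (\<forall>x y. f (x + y) = f x + f y) \<and> (\<forall>c x. f (scl V c x) = scl V c (f x))"
  by (simp add: Vector_Spaces.linear_iff vector_space_axioms)

lemma md_add_left: "md V (x + y) i b = md V x i b + md V y i b"
  and md_scl_left: "md V (scl V c x) i b = scl V c (md V x i b)"
  and md_add_right: "md V a i (x + y) = md V a i x + md V a i y"
  and md_scl_right: "md V a i (scl V c x) = scl V c (md V a i x)"
proof -
  have "\<forall>a i. Vector_Spaces.linear (scl V) (scl V) (md V a i)"
    "\<forall>i b. Vector_Spaces.linear (scl V) (scl V) (\<lambda>a. md V a i b)"
    using VA_tail6[THEN conjunct1] VA_tail6[THEN conjunct2, THEN conjunct1] by this+
  then show "md V (x + y) i b = md V x i b + md V y i b"
    "md V (scl V c x) i b = scl V c (md V x i b)"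
    "md V a i (x + y) = md V a i x + md V a i y"
    "md V a i (scl V c x) = scl V c (md V a i x)"
    unfolding linear_scl_iff by blast+
qed

lemma md_zero_right: "md V a i 0 = 0"
  using md_scl_right[of a i 0 0] by simp

lemma grd_subspace: "subspace (grd V k)"
  by (rule VA[unfolded graded_VA_def, THEN conjunct2, THEN conjunct1, rule_format])

lemma grd_below: "k < Dlt V \<Longrightarrow> grd V k = {0}"
  by (rule VA_tail2[THEN conjunct2, THEN conjunct2, THEN conjunct1, rule_format])

lemma vac_grd: "vac V \<in> grd V 0"
  by (rule VA_tail2[THEN conjunct2, THEN conjunct2, THEN conjunct2, THEN conjunct1])

lemma md_grd: "a \<in> grd V k \<Longrightarrow> b \<in> grd V j \<Longrightarrow> md V a i b \<in> grd V (k - 1 - i + j)"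
  by (rule VA_tail6[THEN conjunct2, THEN conjunct2, THEN conjunct1, rule_format])

lemma md_vac_left: "md V (vac V) i b = (if i = -1 then b else 0)"
  by (rule VA_tail9[THEN conjunct1, rule_format])

lemma md_vac_nonneg: "i \<ge> 0 \<Longrightarrow> md V a i (vac V) = 0"
  by (rule VA_tail9[THEN conjunct2, THEN conjunct1, rule_format])

lemma md_vac_minus_one: "md V a (-1) (vac V) = a"
  by (rule VA_tail9[THEN conjunct2, THEN conjunct2, THEN conjunct1, rule_format])

lemma borcherds:
  assumes "\<And>i. i \<ge> M \<Longrightarrow> md V a (r + int i) b = 0 \<and> md V b (q + int i) c = 0 \<and> md V a (p + int i) c = 0"
  shows "(\<Sum>i<M. scl V (of_int p gchoose i) (md V (md V a (r + int i) b) (p + q - int i) c))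
      = (\<Sum>i<M. scl V ((-1) ^ i * (of_int r gchoose i))
              (md V a (p + r - int i) (md V b (q + int i) c)
               - scl V ((-1) powi r) (md V b (q + r - int i) (md V a (p + int i) c))))"
  by (rule VA_tail9[THEN conjunct2, THEN conjunct2, THEN conjunct2, rule_format]) (rule assms)

section \<open>Homogeneous components and bilinearity of the product\<close>

lemma comp_ex1: "\<exists>!f. finite {k. f k \<noteq> 0} \<and> (\<forall>k. f k \<in> grd V k) \<and> v = (\<Sum>k\<in>{k. f k \<noteq> 0}. f k)"
  by (rule VA_tail2[THEN conjunct1, rule_format])

lemma comp_finite: "finite {k. comp V v k \<noteq> 0}"
  and comp_grd: "comp V v k \<in> grd V k"
  and comp_sum: "(\<Sum>k | comp V v k \<noteq> 0. comp V v k) = v"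
  using theI'[OF comp_ex1[of v]] unfolding comp_def[symmetric] by auto

lemma comp_eqI:
  assumes "finite S" "\<And>k. f k \<noteq> 0 \<Longrightarrow> k \<in> S" "\<And>k. f k \<in> grd V k" "v = sum f S"
  shows "comp V v = f"
  unfolding comp_def
proof (rule the1_equality[OF comp_ex1], intro conjI allI)
  show "finite {k. f k \<noteq> 0}" by (rule finite_subset[OF _ assms(1)]) (use assms(2) in auto)
  show "v = (\<Sum>k\<in>{k. f k \<noteq> 0}. f k)"
    unfolding assms(4) by (rule sum.mono_neutral_right) (use assms in auto)
qed (rule assms(3))

lemma comp_sum_superset:
  assumes "finite S" "\<And>k. comp V v k \<noteq> 0 \<Longrightarrow> k \<in> S"
  shows "v = (\<Sum>k\<in>S. comp V v k)"
  by (subst comp_sum[symmetric], rule sum.mono_neutral_left) (use assms in auto)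

lemma comp_homogeneous: "v \<in> grd V k \<Longrightarrow> comp V v = (\<lambda>j. if j = k then v else 0)"
  by (rule comp_eqI[of "{k}"]) (auto simp: subspace_0[OF grd_subspace] split: if_splits)

lemma comp_add: "comp V (v + w) k = comp V v k + comp V w k"
proof -
  let ?S = "{k. comp V v k \<noteq> 0} \<union> {k. comp V w k \<noteq> 0}"
  have fin: "finite ?S" using comp_finite by blast
  have "v = (\<Sum>k\<in>?S. comp V v k)" "w = (\<Sum>k\<in>?S. comp V w k)"
    by (rule comp_sum_superset[OF fin], blast)+
  then have vw: "v + w = (\<Sum>k\<in>?S. comp V v k + comp V w k)" by (simp add: sum.distrib)
  have "comp V (v + w) = (\<lambda>k. comp V v k + comp V w k)"
    by (rule comp_eqI[OF fin _ _ vw]) (auto simp: comp_grd subspace_add[OF grd_subspace])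
  then show ?thesis by simp
qed

lemma comp_scl: "comp V (scl V c v) k = scl V c (comp V v k)"
proof -
  have vw: "scl V c v = (\<Sum>k | comp V v k \<noteq> 0. scl V c (comp V v k))"
    by (simp add: comp_sum flip: scale_sum_right)
  have "comp V (scl V c v) = (\<lambda>k. scl V c (comp V v k))"
    by (rule comp_eqI[OF comp_finite _ _ vw]) (auto simp: comp_grd subspace_scale[OF grd_subspace])
  then show ?thesis by simp
qed

lemma apl_add_left: "apl V f (x + y) b = apl V f x b + apl V f y b"
  and apl_scl_left: "apl V f (scl V c x) b = scl V c (apl V f x b)"
  and apl_add_right: "apl V f a (x + y) = apl V f a x + apl V f a y"
  and apl_scl_right: "apl V f a (scl V c x) = scl V c (apl V f a x)"
  by (simp_all add: apl_def md_add_left md_scl_left md_add_right md_scl_right scale_right_distrib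
      sum.distrib scale_sum_right mult.commute)

lemma apl_zero_left [simp]: "apl V f 0 b = 0"
  using apl_scl_left[of f 0 0 b] by simp

lemma apl_zero_right [simp]: "apl V f a 0 = 0"
  using apl_scl_right[of f a 0 0] by simp

text \<open>The supports in \<open>star\<close> change under addition; common finite index sets let
  linearity be checked term by term.\<close>

lemma star_superset:
  assumes "finite A" "\<And>k. comp V a k \<noteq> 0 \<Longrightarrow> k \<in> A" "finite B" "\<And>k. comp V b k \<noteq> 0 \<Longrightarrow> k \<in> B"
  shows "star V T n p m a b
    = (\<Sum>\<alpha>\<in>A. \<Sum>\<beta>\<in>B. apl V (Ppoly (Dlt V) T n p m \<alpha> \<beta>) (comp V a \<alpha>) (comp V b \<beta>))"
proof -
  have "star V T n p m a b
      = (\<Sum>\<alpha> | comp V a \<alpha> \<noteq> 0. \<Sum>\<beta>\<in>B. apl V (Ppoly (Dlt V) T n p m \<alpha> \<beta>) (comp V a \<alpha>) (comp V b \<beta>))"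
    unfolding star_def
    by (intro sum.cong[OF refl] sum.mono_neutral_left) (use assms in auto)
  also have "\<dots> = (\<Sum>\<alpha>\<in>A. \<Sum>\<beta>\<in>B. apl V (Ppoly (Dlt V) T n p m \<alpha> \<beta>) (comp V a \<alpha>) (comp V b \<beta>))"
    by (rule sum.mono_neutral_left) (use assms in auto)
  finally show ?thesis .
qed

lemma star_homogeneous:
  assumes "a \<in> grd V \<alpha>" "b \<in> grd V \<beta>"
  shows "star V T n p m a b = apl V (Ppoly (Dlt V) T n p m \<alpha> \<beta>) a b"
  by (subst star_superset[of "{\<alpha>}" _ "{\<beta>}"])
     (auto simp: comp_homogeneous[OF assms(1)] comp_homogeneous[OF assms(2)] split: if_splits)

lemma star_add_left: "star V T n p m (x + y) b = star V T n p m x b + star V T n p m y b"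
proof -
  let ?A = "{k. comp V x k \<noteq> 0} \<union> {k. comp V y k \<noteq> 0}" and ?B = "{k. comp V b k \<noteq> 0}"
  have fin: "finite ?A" "finite ?B" using comp_finite by blast+
  have "star V T n p m z b
      = (\<Sum>\<alpha>\<in>?A. \<Sum>\<beta>\<in>?B. apl V (Ppoly (Dlt V) T n p m \<alpha> \<beta>) (comp V z \<alpha>) (comp V b \<beta>))"
    if "z \<in> {x, y, x + y}" for z
    by (rule star_superset[OF fin(1) _ fin(2)]) (use that in \<open>auto simp: comp_add\<close>)
  then show ?thesis by (simp add: comp_add apl_add_left sum.distrib)
qed

lemma star_add_right: "star V T n p m a (x + y) = star V T n p m a x + star V T n p m a y"
proof -
  let ?B = "{k. comp V x k \<noteq> 0} \<union> {k. comp V y k \<noteq> 0}" and ?A = "{k. comp V a k \<noteq> 0}"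
  have fin: "finite ?A" "finite ?B" using comp_finite by blast+
  have "star V T n p m a z
      = (\<Sum>\<alpha>\<in>?A. \<Sum>\<beta>\<in>?B. apl V (Ppoly (Dlt V) T n p m \<alpha> \<beta>) (comp V a \<alpha>) (comp V z \<beta>))"
    if "z \<in> {x, y, x + y}" for z
    by (rule star_superset[OF fin(1) _ fin(2)]) (use that in \<open>auto simp: comp_add\<close>)
  then show ?thesis by (simp add: comp_add apl_add_right sum.distrib)
qed

lemma star_scl_left: "star V T n p m (scl V c x) b = scl V c (star V T n p m x b)"
  by (subst star_superset[of "{k. comp V x k \<noteq> 0}" _ "{k. comp V b k \<noteq> 0}"])
     (auto simp: comp_finite comp_scl apl_scl_left star_def scale_sum_right)

lemma star_scl_right: "star V T n p m a (scl V c x) = scl V c (star V T n p m a x)"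
  by (subst star_superset[of "{k. comp V a k \<noteq> 0}" _ "{k. comp V x k \<noteq> 0}"])
     (auto simp: comp_finite comp_scl apl_scl_right star_def scale_sum_right)

lemma star_bilin: "bilin (scl V) (star V T n p m)"
  by (simp add: bilin_def linear_scl_iff star_add_left star_add_right star_scl_left star_scl_right)

lemma star_zero_left [simp]: "star V T n p m 0 b = 0"
  using star_scl_left[of n p m 0 0 b] by simp

lemma star_zero_right [simp]: "star V T n p m a 0 = 0"
  using star_scl_right[of n p m a 0 0] by simp

lemma star_diff_left: "star V T n p m (x - y) b = star V T n p m x b - star V T n p m y b"
  using star_add_left[of n p m "x - y" y b] by simp

lemma star_diff_right: "star V T n p m a (x - y) = star V T n p m a x - star V T n p m a y"
  using star_add_right[of n p m a "x - y" y] by simp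

section \<open>The vacuum as a unit\<close>

text \<open>The bridge from polynomials to V: when the modes are binomial multiples of one vector
  modulo W, substituting them into f computes the residue pairing.\<close>

lemma apl_respair:
  assumes W: "subspace W"
    and md: "\<And>k. md V a k b - scl V (if k \<le> -1 then \<rho> gchoose nat (-1 - k) else 0) w \<in> W"
  shows "apl V f a b - scl V (respair \<rho> (-1) f) w \<in> W"
proof -
  have "apl V f a b - scl V (respair \<rho> (-1) f) w
      = (\<Sum>k | f k \<noteq> 0. scl V (f k) (md V a k b - scl V (if k \<le> -1 then \<rho> gchoose nat (-1 - k) else 0) w))"
    by (simp add: apl_def respair_def scale_sum_left scale_right_diff_distrib sum_subtractf)
  also have "\<dots> \<in> W"
    by (intro subspace_sum[OF W] subspace_scale[OF W] md)
  finally show ?thesis .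
qed

lemma mod_homogeneous_decomposition:
  assumes W: "subspace W"
    and add: "\<And>x y. F (x + y) = F x + F y"
    and hom: "\<And>a \<alpha>. a \<in> grd V \<alpha> \<Longrightarrow> F a - a \<in> W"
  shows "F a - a \<in> W"
proof -
  have F0: "F 0 = 0" using add[of 0 0] by simp
  have "F (sum f S) - sum f S \<in> W" if "finite S" "\<And>k. f k \<in> grd V k" for f and S :: "int set"
    using that(1)
  proof induction
    case empty
    show ?case using F0 subspace_0[OF W] by simp
  next
    case (insert k S)
    have "F (sum f (insert k S)) - sum f (insert k S) = (F (f k) - f k) + (F (sum f S) - sum f S)"
      using insert.hyps by (simp add: add)
    then show ?case using subspace_add[OF W hom[OF that(2)] insert.IH] by metis
  qed
  from this[of "{k. comp V a k \<noteq> 0}" "comp V a"] show ?thesis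
    by (simp add: comp_sum comp_finite comp_grd)
qed

text \<open>As 1_k b = binom(0, -1-k) b, the exponent is \<rho> = 0. Here p = n gives r = 0 and
  \<mu> = -h-1 with h = m div T, whose node h - Q is 0. Taking W = {0} makes the congruence an
  equality.\<close>

lemma star_vac_left: "star V T n n m (vac V) b = b"
proof -
  have W: "subspace {0}" by simp
  have "star V T n n m (vac V) b - b \<in> {0}"
  proof (rule mod_homogeneous_decomposition[OF W star_add_right])
    fix b \<beta> assume b: "b \<in> grd V \<beta>"
    show "star V T n n m (vac V) b - b \<in> {0}"
    \<comment> \<open>Below \<Delta> the vector is zero; otherwise N \<ge> -1, as
      \<open>respair_Ppoly\<close> demands.\<close>
    proof (cases "\<beta> < Dlt V")
      case True
      then show ?thesis using b grd_below by auto
    next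
      case False
      let ?P = "Ppoly (Dlt V) T n n m 0 \<beta>"
      have Q: "of_nat (m div T) - Qs T m 0 0 = 0" by (simp add: Qs_def dl_def)
      have "respair (of_nat (m div T) - Qs T m 0 0) (-1) ?P = 1"
        by (rule respair_Ppoly) (use False T_pos in \<open>auto simp: dl_def not_le\<close>)
      then have "respair 0 (-1) ?P = 1" by (simp only: Q)
      moreover have "apl V ?P (vac V) b - scl V (respair 0 (-1) ?P) b \<in> {0}"
        by (rule apl_respair[OF W]) (auto simp: md_vac_left gbinomial_0_left)
      ultimately show ?thesis by (simp add: star_homogeneous[OF vac_grd b])
    qed
  qed
  then show ?thesis by simp
qed

text \<open>The translation rule (Da)_j = -j a_(j-1) applied to the vacuum, where Da = a_(-2)
  1.\<close>

lemma md_derivative_vac: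
  "md V (md V a (-2) (vac V)) (-1 - int k) (vac V) = scl V (of_nat (Suc k)) (md V a (-2 - int k) (vac V))"
proof -
  \<comment> \<open>Borcherds identity with p = 0, r = -2, q = -1-k: on the left only i = 0 remains,
    on the right only i = k, where 1_(-1) acts. All modes required to vanish do so from i = k + 2
    on.\<close>
  have "(\<Sum>i<k + 2. scl V (of_int 0 gchoose i) (md V (md V a (-2 + int i) (vac V)) (0 + (-1 - int k) - int i) (vac V)))
      = (\<Sum>i<k + 2. scl V ((-1) ^ i * (of_int (-2) gchoose i))
              (md V a (0 + -2 - int i) (md V (vac V) (-1 - int k + int i) (vac V))
               - scl V ((-1) powi (-2)) (md V (vac V) (-1 - int k + -2 - int i) (md V a (0 + int i) (vac V)))))"
    by (rule borcherds) (auto simp: md_vac_nonneg md_vac_left)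
  also have "\<dots> = (\<Sum>i<k + 2. if i = k then scl V ((-1) ^ k * (of_int (-2) gchoose k)) (md V a (-2 - int k) (vac V)) else 0)"
    by (rule sum.cong) (auto simp: md_vac_nonneg md_vac_left md_zero_right)
  also have "\<dots> = scl V ((-1) ^ k * ((-2) gchoose k)) (md V a (-2 - int k) (vac V))"
    by simp
  also have "(-1) ^ k * ((-2) gchoose k) = (of_nat (Suc k) :: complex)"
  proof -
    have "(-1) ^ k * ((-2) gchoose k) = ((2 + of_nat k - 1) gchoose k :: complex)"
      by (subst gbinomial_minus) (simp flip: mult.assoc power_mult_distrib)
    also have "(2 + of_nat k - 1 :: complex) = of_nat (Suc k)" by simp
    also have "(of_nat (Suc k) gchoose k :: complex) = of_nat (Suc k)"
      by (simp only: binomial_gbinomial[symmetric] binomial_Suc_n)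
    finally show ?thesis .
  qed
  also have "(\<Sum>i<k + 2. scl V (of_int 0 gchoose i) (md V (md V a (-2 + int i) (vac V)) (0 + (-1 - int k) - int i) (vac V)))
      = (\<Sum>i<k + 2. if i = 0 then md V (md V a (-2) (vac V)) (-1 - int k) (vac V) else 0)"
    by (rule sum.cong) (auto simp: gbinomial_0_left)
  finally show ?thesis by (simp split: if_splits)
qed

text \<open>With x = wt a + m - n, Da is congruent to -x a. Repeated translation raises the weight
  by one each time and yields (-x)(-x-1)... divided by a factorial.\<close>

lemma md_vac_mod_O0:
  assumes "a \<in> grd V \<alpha>"
  shows "md V a (-1 - int k) (vac V)
    - scl V (- (of_int \<alpha> + (of_nat m - of_nat n) / of_nat T) gchoose k) a \<in> O0 V T n m"
  using assms
proof (induction k arbitrary: a \<alpha>)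
  case 0
  then show ?case by (simp add: md_vac_minus_one O0_def span_zero)
next
  case (Suc k)
  define x :: complex where "x = of_int \<alpha> + (of_nat m - of_nat n) / of_nat T"
  define Da where "Da = md V a (-2) (vac V)"
  have O0: "subspace (O0 V T n m)" by (simp add: O0_def)
  have Da: "Da \<in> grd V (\<alpha> + 1)" using md_grd[OF Suc.prems vac_grd, of "-2"] by (simp add: Da_def add.commute)
  have IH: "md V Da (-1 - int k) (vac V) - scl V (- x - 1 gchoose k) Da \<in> O0 V T n m"
  proof -
    have "- (of_int (\<alpha> + 1) + (of_nat m - of_nat n) / of_nat T) = - x - 1" by (simp add: x_def)
    with Suc.IH[OF Da] show ?thesis by (simp only:)
  qed
  have "Da + scl V x a \<in> O0 V T n m"
    unfolding O0_def Da_def x_def by (rule span_base) (use Suc.prems in auto)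
  from subspace_add[OF O0 IH subspace_scale[OF O0 this, of "- x - 1 gchoose k"]]
  have "scl V (of_nat (Suc k)) (md V a (-2 - int k) (vac V)) + scl V ((- x - 1 gchoose k) * x) a \<in> O0 V T n m"
    by (simp add: Da_def md_derivative_vac scale_right_distrib)
  from subspace_scale[OF O0 this, of "1 / of_nat (Suc k)"]
  have "md V a (-2 - int k) (vac V) + scl V ((- x - 1 gchoose k) * x / of_nat (Suc k)) a \<in> O0 V T n m"
    by (simp add: scale_right_distrib del: of_nat_Suc)
  \<comment> \<open>Absorption combines the factor x/(k+1) with the binomial for weight \<alpha> +
    1.\<close>
  moreover have "(- x - 1 gchoose k) * x / of_nat (Suc k) = - (- x gchoose Suc k)"
    using gbinomial_absorption[of k "- x"] by (simp add: field_simps del: of_nat_Suc)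
  ultimately show ?case by (simp add: x_def)
qed

text \<open>Matches the node n div T - Q with the exponent of \<open>md_vac_mod_O0\<close>. With i =
  m mod T and j = n mod T, r is i - j or T + i - j; accordingly just one of the two conditions r
  \<le> i and T \<le> r + j holds.\<close>

lemma Qs_residue_difference:
  assumes r: "r = nat ((int m - int n) mod int T)"
  shows "of_nat (n div T) - Qs T m \<alpha> r = - (of_int \<alpha> + (of_nat m - of_nat n) / of_nat T)"
    and "dl (r \<le> m mod T) + dl (T \<le> r + n mod T) = 1"
proof -
  define i j where "i = m mod T" and "j = n mod T"
  have ij: "i < T" "j < T" using T_pos by (auto simp: i_def j_def)
  have "(int m - int n) mod int T = (int i - int j) mod int T"
    by (simp add: i_def j_def zmod_int mod_diff_eq)
  also have "\<dots> = (if j \<le> i then int i - int j else int T + int i - int j)"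
  proof (cases "j \<le> i")
    case True
    then show ?thesis using ij by simp
  next
    case False
    have "(int i - int j) mod int T = (int T + int i - int j) mod int T"
      by (metis add_diff_eq mod_add_self1)
    then show ?thesis using False ij by simp
  qed
  finally have r': "int r = (if j \<le> i then int i - int j else int T + int i - int j)"
    using ij by (simp add: r)
  then show "dl (r \<le> m mod T) + dl (T \<le> r + n mod T) = 1"
    using ij unfolding i_def[symmetric] j_def[symmetric] by (auto simp: dl_def split: if_splits)
  have m: "of_nat m = (of_nat (m div T) * of_nat T + of_nat i :: complex)"
    and n: "of_nat n = (of_nat (n div T) * of_nat T + of_nat j :: complex)"
    by (simp_all add: i_def j_def flip: of_nat_mult of_nat_add)
  have dl_r: "dl (r \<le> i) = dl (j \<le> i)" using r' ij by (auto simp: dl_def split: if_splits)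
  have "of_nat r = (of_int (int r) :: complex)" by simp
  also have "\<dots> = of_nat i - of_nat j + (1 - of_int (dl (r \<le> i))) * of_nat T"
    unfolding r' dl_r by (simp add: dl_def)
  finally have rc: "of_nat r = (of_nat i - of_nat j + (1 - of_int (dl (r \<le> i))) * of_nat T :: complex)" .
  show "of_nat (n div T) - Qs T m \<alpha> r = - (of_int \<alpha> + (of_nat m - of_nat n) / of_nat T)"
    unfolding Qs_def i_def[symmetric] m n rc using T_pos by (simp add: field_simps)
qed

text \<open>Here p = m, so \<mu> = -h-1 with h = n div T, and the node h - Q is the \<rho> for which
  the modes a_k 1 are binomial multiples of a modulo \<open>O0\<close>.\<close>

lemma star_vac_right: "star V T n m m a (vac V) - a \<in> O0 V T n m"
proof (rule mod_homogeneous_decomposition[OF _ star_add_left])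
  show W: "subspace (O0 V T n m)" by (simp add: O0_def)
  fix a \<alpha> assume a: "a \<in> grd V \<alpha>"
  show "star V T n m m a (vac V) - a \<in> O0 V T n m"
  proof (cases "\<alpha> < Dlt V")
    case True
    then show ?thesis using a grd_below subspace_0[OF W] by auto
  next
    case False
    let ?P = "Ppoly (Dlt V) T n m m \<alpha> 0"
    define r where "r = nat ((int m - int n) mod int T)"
    define \<rho> where "\<rho> = - (of_int \<alpha> + (of_nat m - of_nat n) / of_nat T :: complex)"
    have "respair (of_nat (n div T) - Qs T m \<alpha> r) (-1) ?P = 1"
      by (rule respair_Ppoly[OF T_pos _ r_def]) (use False Qs_residue_difference(2)[OF r_def] in auto)
    then have P: "respair \<rho> (-1) ?P = 1"
      by (simp only: Qs_residue_difference(1)[OF r_def] \<rho>_def)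
    have "apl V ?P a (vac V) - scl V (respair \<rho> (-1) ?P) a \<in> O0 V T n m"
    proof (rule apl_respair[OF W])
      fix k :: int
      show "md V a k (vac V) - scl V (if k \<le> -1 then \<rho> gchoose nat (-1 - k) else 0) a \<in> O0 V T n m"
      proof (cases "k \<le> -1")
        case True
        then have "k = -1 - int (nat (-1 - k))" by simp
        then show ?thesis using md_vac_mod_O0[OF a, of "nat (-1 - k)" m n] True by (simp add: \<rho>_def)
      next
        case False
        then show ?thesis by (simp add: md_vac_nonneg subspace_0[OF W])
      qed
    qed
    then show ?thesis by (simp add: P star_homogeneous[OF a vac_grd])
  qed
qed

subsection \<open>The subspaces as a two-sided ideal\<close>

lemma additive_span_image:
  assumes x: "x \<in> span S" and W: "subspace W"
    and add: "\<And>x y. F (x + y) = F x + F y" and scl: "\<And>c x. F (scl V c x) = scl V c (F x)"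
    and base: "\<And>x. x \<in> S \<Longrightarrow> F x \<in> W"
  shows "F x \<in> W"
  using x
proof (induction rule: span_induct_alt)
  case base
  have "F 0 = 0" using add[of 0 0] by simp
  then show ?case using subspace_0[OF W] by simp
next
  case (step c x y)
  then show ?case using base by (simp add: add scl subspace_add[OF W] subspace_scale[OF W])
qed

lemma subspace_O2: "subspace (O2 V T n m)" and subspace_Otot: "subspace (Otot V T n m)"
  by (simp_all add: O2_def Otot_def)

lemma O_subset_Otot:
  "O0 V T n m \<subseteq> Otot V T n m" "O1 V T n m \<subseteq> Otot V T n m"
  "O2 V T n m \<subseteq> Otot V T n m" "O3 V T n m \<subseteq> Otot V T n m"
  unfolding Otot_def by (blast intro: span_base)+

text \<open>The factors compose like arrows m to p1 to p2 to n, with c applied first.\<close>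

definition associator :: "nat \<Rightarrow> nat \<Rightarrow> nat \<Rightarrow> nat \<Rightarrow> 'v \<Rightarrow> 'v \<Rightarrow> 'v \<Rightarrow> 'v" where
  "associator n p2 p1 m a b c
    = star V T n p1 m (star V T n p2 p1 a b) c - star V T n p2 m a (star V T p2 p1 m b c)"

lemma star_associator_O2: "star V T n q m u (associator q p2 p1 m a b c) \<in> O2 V T n m"
  unfolding O2_def associator_def by (rule span_base) blast

lemma associator_O2: "associator n p2 p1 m a b c \<in> O2 V T n m"
  using star_associator_O2[of n n m "vac V" p2 p1 a b c] by (simp add: star_vac_left)

text \<open>Moving the brackets to (u * v) * z costs one more associator, and both terms lie in
  \<open>O2\<close>.\<close>

lemma star_star_associator_O2:
  "star V T n q m u (star V T q p m v (associator p p2 p1 m a b c)) \<in> O2 V T n m"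
proof -
  let ?z = "associator p p2 p1 m a b c"
  have "star V T n q m u (star V T q p m v ?z)
      = star V T n p m (star V T n q p u v) ?z - associator n q p m u v ?z"
    by (simp add: associator_def[of n q p])
  then show ?thesis
    using subspace_diff[OF subspace_O2 star_associator_O2 associator_O2] by metis
qed

text \<open>The pentagon identity.\<close>
lemma associator_star:
  "star V T q p m (associator q p2 p1 p a b c) d
    = associator q p1 p m (star V T q p2 p1 a b) c d
      + associator q p2 p1 m a b (star V T p1 p m c d)
      - associator q p2 p m a (star V T p2 p1 p b c) d
      - star V T q p2 m a (associator p2 p1 p m b c d)"
  by (simp add: associator_def star_diff_left star_diff_right)

lemma O2_star:
  assumes "x \<in> O2 V T n p"
  shows "star V T n p m x d \<in> O2 V T n m"
proof (rule additive_span_image[OF assms[unfolded O2_def] subspace_O2 star_add_left star_scl_left])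
  fix x
  assume "x \<in> {star V T n p3 p u (star V T p3 p1 p (star V T p3 p2 p1 a b) c
      - star V T p3 p2 p a (star V T p2 p1 p b c)) | u a b c p1 p2 p3. True}"
  then obtain u a b c p1 p2 q where x: "x = star V T n q p u (associator q p2 p1 p a b c)"
    unfolding associator_def by blast
  let ?y = "associator q p2 p1 p a b c"
  have "star V T n p m x d = associator n q p m u ?y d + star V T n q m u (star V T q p m ?y d)"
    by (simp add: x associator_def[of n q p])
  moreover have "star V T n q m u (star V T q p m ?y d) \<in> O2 V T n m"
    \<comment> \<open>After the pentagon expansion of ?y * d, left multiplication by u gives three
      terms u * associator and one term u * (a * associator).\<close>
    unfolding associator_star star_diff_right star_add_right
    by (intro subspace_diff[OF subspace_O2] subspace_add[OF subspace_O2]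
        star_associator_O2 star_star_associator_O2)
  ultimately show "star V T n p m x d \<in> O2 V T n m"
    using subspace_add[OF subspace_O2 associator_O2] by metis
qed

lemma star_O01_star_O3:
  assumes "y \<in> O0 V T p2 p1 \<union> O1 V T p2 p1"
  shows "star V T n p1 m (star V T n p2 p1 u y) c \<in> O3 V T n m"
proof -
  have "0 \<in> O0 V T p2 p1" "0 \<in> O1 V T p2 p1" by (auto simp: O0_def O1_def span_zero)
  then have "y \<in> {x + w | x w. x \<in> O0 V T p2 p1 \<and> w \<in> O1 V T p2 p1}"
    using assms by (metis (mono_tags, lifting) UnE add.left_neutral add.right_neutral mem_Collect_eq)
  then show ?thesis unfolding O3_def by (intro span_base) blast
qed

lemma O3_generator_cases:
  assumes "x \<in> {star V T n p1 m (star V T n p2 p1 u y) c | u c p1 p2 y.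
        y \<in> {x + w | x w. x \<in> O0 V T p2 p1 \<and> w \<in> O1 V T p2 p1}}"
    and W: "subspace W"
    and step: "\<And>u c p1 p2 y. y \<in> O0 V T p2 p1 \<union> O1 V T p2 p1 \<Longrightarrow>
        F (star V T n p1 m (star V T n p2 p1 u y) c) \<in> W"
    and add: "\<And>x y. F (x + y) = F x + F y"
  shows "F x \<in> W"
proof -
  from assms(1) obtain u c p1 p2 y w where
    "x = star V T n p1 m (star V T n p2 p1 u (y + w)) c" "y \<in> O0 V T p2 p1" "w \<in> O1 V T p2 p1"
    by blast
  then show ?thesis
    by (auto simp: star_add_left star_add_right add intro!: subspace_add[OF W] step)
qed

lemma Otot_star:
  assumes "x \<in> Otot V T n p"
  shows "star V T n p m x d \<in> Otot V T n m"
proof (rule additive_span_image[OF assms[unfolded Otot_def] subspace_Otot star_add_left star_scl_left])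
  fix x assume "x \<in> O0 V T n p \<union> O1 V T n p \<union> O2 V T n p \<union> O3 V T n p"
  then consider "x \<in> O0 V T n p \<union> O1 V T n p" | "x \<in> O2 V T n p" | "x \<in> O3 V T n p" by blast
  then show "star V T n p m x d \<in> Otot V T n m"
  proof cases
    case 1
    then show ?thesis
      using star_O01_star_O3[of x n p n m "vac V" d] O_subset_Otot(4) by (auto simp: star_vac_left)
  next
    case 2
    then show ?thesis using O2_star O_subset_Otot(3) by blast
  next
    case 3
    show ?thesis
    proof (rule additive_span_image[OF 3[unfolded O3_def] subspace_Otot star_add_left star_scl_left],
        erule O3_generator_cases[OF _ subspace_Otot _ star_add_left])
      fix u c p1 p2 y assume y: "y \<in> O0 V T p2 p1 \<union> O1 V T p2 p1"
      let ?uy = "star V T n p2 p1 u y"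
      \<comment> \<open>Reassociating absorbs d into the last factor c, which gives another
        generator of \<open>O3\<close>.\<close>
      have "star V T n p m (star V T n p1 p ?uy c) d
          = associator n p1 p m ?uy c d + star V T n p1 m ?uy (star V T p1 p m c d)"
        by (simp add: associator_def)
      moreover have "associator n p1 p m ?uy c d \<in> Otot V T n m"
        using associator_O2 O_subset_Otot(3) by blast
      moreover have "star V T n p1 m ?uy (star V T p1 p m c d) \<in> Otot V T n m"
        using star_O01_star_O3[OF y] O_subset_Otot(4) by blast
      ultimately show "star V T n p m (star V T n p1 p ?uy c) d \<in> Otot V T n m"
        using subspace_add[OF subspace_Otot] by metis
    qed
  qed
qed

lemma star_Otot:
  assumes "x \<in> Otot V T p m"
  shows "star V T n p m u x \<in> Otot V T n m"
proof (rule additive_span_image[OF assms[unfolded Otot_def] subspace_Otot star_add_right star_scl_right])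
  fix x assume "x \<in> O0 V T p m \<union> O1 V T p m \<union> O2 V T p m \<union> O3 V T p m"
  then consider "x \<in> O0 V T p m \<union> O1 V T p m" | "x \<in> O2 V T p m" | "x \<in> O3 V T p m" by blast
  then show "star V T n p m u x \<in> Otot V T n m"
  proof cases
    case 1
    let ?z = "star V T n p m u x"
    \<comment> \<open>Multiplying by 1 on the right makes u * x the inner factor of an
      \<open>O3\<close> generator; removing the 1 costs an element of \<open>O0\<close>.\<close>
    have "star V T n m m ?z (vac V) \<in> Otot V T n m"
      using star_O01_star_O3[OF 1] O_subset_Otot(4) by blast
    moreover have "star V T n m m ?z (vac V) - ?z \<in> Otot V T n m"
      using star_vac_right O_subset_Otot(1) by blast
    ultimately have "star V T n m m ?z (vac V) - (star V T n m m ?z (vac V) - ?z) \<in> Otot V T n m"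
      by (rule subspace_diff[OF subspace_Otot])
    then show ?thesis by simp
  next
    case 2
    have "star V T n p m u x \<in> O2 V T n m"
    proof (rule additive_span_image[OF 2[unfolded O2_def] subspace_O2 star_add_right star_scl_right])
      fix x
      assume "x \<in> {star V T p p3 m u (star V T p3 p1 m (star V T p3 p2 p1 a b) c
          - star V T p3 p2 m a (star V T p2 p1 m b c)) | u a b c p1 p2 p3. True}"
      then obtain v a b c p1 p2 q where x: "x = star V T p q m v (associator q p2 p1 m a b c)"
        unfolding associator_def by blast
      show "star V T n p m u x \<in> O2 V T n m" unfolding x by (rule star_star_associator_O2)
    qed
    then show ?thesis using O_subset_Otot(3) by blast
  next
    case 3
    show ?thesis
    proof (rule additive_span_image[OF 3[unfolded O3_def] subspace_Otot star_add_right star_scl_right],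
        erule O3_generator_cases[OF _ subspace_Otot _ star_add_right])
      fix v c p1 p2 y assume y: "y \<in> O0 V T p2 p1 \<union> O1 V T p2 p1"
      let ?vy = "star V T p p2 p1 v y" and ?uv = "star V T n p p2 u v"
      \<comment> \<open>Two reassociations move u next to v. The first associator is still
        multiplied by c, hence the appeal to \<open>O2_star\<close>.\<close>
      have "star V T n p m u (star V T p p1 m ?vy c)
          = star V T n p1 m (star V T n p2 p1 ?uv y) c
            - star V T n p1 m (associator n p p2 p1 u v y) c - associator n p p1 m u ?vy c"
        by (simp add: associator_def star_diff_left)
      moreover have "associator n p p1 m u ?vy c \<in> Otot V T n m"
        using associator_O2 O_subset_Otot(3) by blast
      moreover have "star V T n p1 m (associator n p p2 p1 u v y) c \<in> Otot V T n m"
        using O2_star[OF associator_O2] O_subset_Otot(3) by blast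
      moreover have "star V T n p1 m (star V T n p2 p1 ?uv y) c \<in> Otot V T n m"
        using star_O01_star_O3[OF y] O_subset_Otot(4) by blast
      ultimately show "star V T n p m u (star V T p p1 m ?vy c) \<in> Otot V T n m"
        using subspace_diff[OF subspace_Otot] by metis
    qed
  qed
qed

lemma star_well_defined:
  assumes "a - a' \<in> Otot V T n p" "b - b' \<in> Otot V T p m"
  shows "star V T n p m a b - star V T n p m a' b' \<in> Otot V T n m"
proof -
  have "star V T n p m a b - star V T n p m a' b'
      = star V T n p m (a - a') b + star V T n p m a' (b - b')"
    by (simp add: star_diff_left star_diff_right)
  then show ?thesis
    using subspace_add[OF subspace_Otot Otot_star[OF assms(1)] star_Otot[OF assms(2)]] by metis
qed

lemma star_assoc_Otot:
  "star V T n p1 m (star V T n p2 p1 a b) c - star V T n p2 m a (star V T p2 p1 m b c) \<in> Otot V T n m"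
  using associator_O2[of n p2 p1 m a b c] O_subset_Otot(3) unfolding associator_def by blast

end

theorem mainTheorem10:
  fixes V :: "('v::ab_group_add) gVA" and T mm nn :: nat
  assumes "graded_VA V" and "T > 0"
  shows
   \<comment> \<open>A^T_m(V): *^T_{m,m,m} is well defined on V / O^T_{m,m}(V), bilinear, associative, unit [1]\<close>
   "(\<forall>a a' b b'. a - a' \<in> Otot V T mm mm \<longrightarrow> b - b' \<in> Otot V T mm mm \<longrightarrow>
        star V T mm mm mm a b - star V T mm mm mm a' b' \<in> Otot V T mm mm)
  \<and> bilin (scl V) (star V T mm mm mm)
  \<and> (\<forall>a b c. star V T mm mm mm (star V T mm mm mm a b) c
             - star V T mm mm mm a (star V T mm mm mm b c) \<in> Otot V T mm mm)
  \<and> (\<forall>a. star V T mm mm mm (vac V) a - a \<in> Otot V T mm mm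
        \<and> star V T mm mm mm a (vac V) - a \<in> Otot V T mm mm)
   \<comment> \<open>A^T_{n,m}(V) is an A^T_n(V)-A^T_m(V)-bimodule\<close>
  \<and> (\<forall>a a' b b'. a - a' \<in> Otot V T nn nn \<longrightarrow> b - b' \<in> Otot V T nn mm \<longrightarrow>
        star V T nn nn mm a b - star V T nn nn mm a' b' \<in> Otot V T nn mm)
  \<and> (\<forall>b b' c c'. b - b' \<in> Otot V T nn mm \<longrightarrow> c - c' \<in> Otot V T mm mm \<longrightarrow>
        star V T nn mm mm b c - star V T nn mm mm b' c' \<in> Otot V T nn mm)
  \<and> bilin (scl V) (star V T nn nn mm)
  \<and> bilin (scl V) (star V T nn mm mm)
  \<and> (\<forall>a a' b. star V T nn nn mm (star V T nn nn nn a a') b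
             - star V T nn nn mm a (star V T nn nn mm a' b) \<in> Otot V T nn mm)
  \<and> (\<forall>b. star V T nn nn mm (vac V) b - b \<in> Otot V T nn mm)
  \<and> (\<forall>b c c'. star V T nn mm mm (star V T nn mm mm b c) c'
             - star V T nn mm mm b (star V T mm mm mm c c') \<in> Otot V T nn mm)
  \<and> (\<forall>b. star V T nn mm mm b (vac V) - b \<in> Otot V T nn mm)
  \<and> (\<forall>a b c. star V T nn mm mm (star V T nn nn mm a b) c
             - star V T nn nn mm a (star V T nn mm mm b c) \<in> Otot V T nn mm)"
proof -
  interpret graded_vertex_algebra V T using assms by unfold_locales
  have left: "star V T n n m (vac V) b - b \<in> Otot V T n m" for n m b
    using subspace_0[OF subspace_Otot] by (simp add: star_vac_left)
  have right: "star V T n m m a (vac V) - a \<in> Otot V T n m" for n m a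
    using star_vac_right O_subset_Otot(1) by blast
  \<comment> \<open>All algebra and bimodule laws are specializations of lemmas stated for arbitrary
    indices.\<close>
  show ?thesis
    by (intro conjI allI impI star_well_defined star_bilin star_assoc_Otot left right)
qed

end
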